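(* Let $k\ge 1$, let $M_1,\dots,M_k$ be matroids on a common finite ground set $U$, and let $\mathbf{x}\in\bigcap_{i=1}^k P(M_i)$, where $P(M_i)$ is the independence polytope of $M_i$. Let $a_e\in[0,1]$ for each $e\in U$, and let $S$ be the (random) output of the $k$-matroid AW contention resolution scheme on $M_1,\dots,M_k$ and $\mathbf{x}$. Let $Q=\sum_{e\in U}a_e x_e$ and $a(S):=\sum_{e\in S}a_e$. Then for all $\delta\in(0,1/5)$, $$\Pr\left[a(S)\le\left(\frac15-\delta\right)\frac{Q}{k+1}\right]\le 4\exp\left(-\frac{\delta^2 Q}{3(k+1)^3}\right).$$
   Context: For a matroid $M=(U,\mathcal I)$, $P(M)\subseteq[0,1]^U$ is the convex hull of the indicator vectors of independent sets. Let $n=|U|$. Exchange mapping: for independent sets $I,J\in\mathcal I$, an exchange mapping is a function $\phi:I\to J\cup\{\perp\}$ such that (1) $\phi(e)=e$ if $e\in I\cap J$; (2) if $\phi(e)=\perp$ then $J+e\in\mathcal I$; (3) if $\phi(e)=f\ne\perp$ then $J+e-f\in\mathcal I$; (4) for every $f\in J$ there is at most one $e\in I$ with $\phi(e)=f$. Such mappings always exist. Single-matroid AW scheme (random-order contention resolution scheme of Adamczyk and W\l{}odarczyk). Input: a matroid $M=(U,\mathcal I)$, a point $\mathbf{x}\in P(M)$, and a random set $R\subseteq U$ containing each $e$ independently with probability $x_e$. Initialization: $S=\emptyset$; write $\mathbf{x}=\sum_{i=1}^{m}\beta_i\mathbf 1_{I_i}$ as a convex combination ($\beta_i\ge0$,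 $\sum_i\beta_i=1$, $m\le n+1$) of indicator vectors of independent sets $I_1,\dots,I_m$; the sets $I_i$ will be updated over time, the weights $\beta_i$ never change. Each element $e$ with $x_e>0$ independently selects a controller index $i$ among those with $e\in I_i$, $\beta_i\neq 0$ (for the initial sets), index $i$ being selected with probability $\beta_i/x_e$. For each ordered pair $(i,j)$ the scheme maintains an exchange mapping $\phi_{ij}$ from the current $I_i$ to the current $I_j$. Iteration: choose a uniformly random ordering $\sigma:[n]\to U$ and process elements in this order. When $e=\sigma(t)$ is processed, $e$ is added to $S$ if and only if $e\in R$ and $e$ still belongs to the current set $I_i$, where $i$ is the controller of $e$. If $e$ is added to $S$, every $I_j$ with $\beta_j\ne0$ is updated by deleting $\phi_{ij}(e)$ (if $\phi_{ij}(e)\ne\perp$) and adding $e$. The output is the final $S$. $k$-matroid AW scheme: given $M_1,\dots,M_k$ and $\mathbf{x}\in\bigcap_i P(M_i)$, run the single-matroid AW scheme for each $M_j$ (with its own decomposition, controllers and exchange mappings) using the same random order $\sigma$ and the same random set $R$, obtaining $S_1,\dots,S_k$; output $S=\bigcap_{j=1}^k S_j$. *)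

theory Defs
  imports "HOL-Probability.Probability" "HOL-Probability.Product_PMF"
    "HOL-Combinatorics.Multiset_Permutations"
begin

locale matroid =
  fixes U :: "'a set" and Ind :: "'a set set"
  assumes finite_ground: "finite U"
    and indep_subset_ground: "I \<in> Ind \<Longrightarrow> I \<subseteq> U"
    and indep_empty: "{} \<in> Ind"
    and indep_mono: "J \<in> Ind \<Longrightarrow> I \<subseteq> J \<Longrightarrow> I \<in> Ind"
    and indep_augment: "I \<in> Ind \<Longrightarrow> J \<in> Ind \<Longrightarrow> card I < card J \<Longrightarrow>
      \<exists>e \<in> J - I. insert e I \<in> Ind"

definition indicator_vec :: "'a::finite set \<Rightarrow> real ^ 'a" where
  "indicator_vec I = (\<chi> e. indicator I e)"

definition indep_polytope :: "'a::finite set set \<Rightarrow> (real ^ 'a) set" where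
  "indep_polytope Ind = convex hull (indicator_vec ` Ind)"

text \<open>\<^const>\<open>None\<close> plays the role of \<open>\<bottom>\<close>. Only the values of \<open>\<phi>\<close> on \<open>I\<close> matter.\<close>

definition exchange_mapping ::
  "'a set set \<Rightarrow> 'a set \<Rightarrow> 'a set \<Rightarrow> ('a \<Rightarrow> 'a option) \<Rightarrow> bool" where
  "exchange_mapping Ind I J \<phi> \<longleftrightarrow>
     (\<forall>e\<in>I. \<forall>f. \<phi> e = Some f \<longrightarrow> f \<in> J) \<and>
     (\<forall>e\<in>I \<inter> J. \<phi> e = Some e) \<and>
     (\<forall>e\<in>I. \<phi> e = None \<longrightarrow> insert e J \<in> Ind) \<and>
     (\<forall>e\<in>I. \<forall>f. \<phi> e = Some f \<longrightarrow> insert e J - {f} \<in> Ind) \<and>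
     (\<forall>f\<in>J. \<forall>e\<in>I. \<forall>e'\<in>I. \<phi> e = Some f \<longrightarrow> \<phi> e' = Some f \<longrightarrow> e = e')"

definition convex_decomposition ::
  "'a::finite set \<Rightarrow> 'a set set \<Rightarrow> real ^ 'a \<Rightarrow> nat \<Rightarrow> (nat \<Rightarrow> real) \<Rightarrow> (nat \<Rightarrow> 'a set) \<Rightarrow> bool" where
  "convex_decomposition U Ind x m \<beta> I \<longleftrightarrow>
     m \<le> card U + 1 \<and>
     (\<forall>i<m. I i \<in> Ind \<and> 0 \<le> \<beta> i) \<and>
     (\<Sum>i<m. \<beta> i) = 1 \<and>
     x = (\<Sum>i<m. \<beta> i *\<^sub>R indicator_vec (I i))"

text \<open>
  The past of a run of the single-matroid scheme: for each element processed so far, in order,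
  the element, whether it is in \<open>R\<close>, and its controller.
\<close>

type_synonym 'a history = "('a \<times> bool \<times> nat) list"

text \<open>
  The scheme may maintain any exchange mappings. A rule \<open>\<Phi>\<close> fixes this choice: after the past
  \<open>h\<close>, with current sets \<open>I\<close>, the mapping from \<open>I i\<close> to \<open>I j\<close> is \<open>\<Phi> h I i j\<close>. The choice may
  depend on everything revealed so far, but not on the element processed next nor on the
  membership in \<open>R\<close> or the controllers of elements not yet processed.
\<close>

type_synonym 'a exchange_rule =
  "'a history \<Rightarrow> (nat \<Rightarrow> 'a set) \<Rightarrow> nat \<Rightarrow> nat \<Rightarrow> 'a \<Rightarrow> 'a option"

definition valid_exchange_rule :: "'a set set \<Rightarrow> nat \<Rightarrow> 'a exchange_rule \<Rightarrow> bool" where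
  "valid_exchange_rule Ind m \<Phi> \<longleftrightarrow>
     (\<forall>h I. (\<forall>i<m. I i \<in> Ind) \<longrightarrow>
        (\<forall>i<m. \<forall>j<m. exchange_mapping Ind (I i) (I j) (\<Phi> h I i j)))"

definition controller_pmf ::
  "real ^ 'a::finite \<Rightarrow> nat \<Rightarrow> (nat \<Rightarrow> real) \<Rightarrow> (nat \<Rightarrow> 'a set) \<Rightarrow> 'a \<Rightarrow> nat pmf" where
  "controller_pmf x m \<beta> I e =
     embed_pmf (\<lambda>i. if i < m \<and> \<beta> i \<noteq> 0 \<and> e \<in> I i then \<beta> i / x $ e else 0)"

text \<open>\<^const>\<open>embed_pmf\<close> is only meaningful for a probability mass function.\<close>

lemma pmf_controller_pmf:
  assumes "convex_decomposition U Ind x m \<beta> I" and "x $ e > 0"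
  shows "pmf (controller_pmf x m \<beta> I e) i =
    (if i < m \<and> \<beta> i \<noteq> 0 \<and> e \<in> I i then \<beta> i / x $ e else 0)"
proof -
  let ?f = "\<lambda>i. if i < m \<and> \<beta> i \<noteq> 0 \<and> e \<in> I i then \<beta> i / x $ e else 0"
  have nonneg: "?f i \<ge> 0" for i
    using assms by (auto simp: convex_decomposition_def)
  have "x $ e = (\<Sum>i<m. \<beta> i * indicator (I i) e)"
    using assms(1) by (auto simp: convex_decomposition_def indicator_vec_def)
  moreover have "(\<Sum>i<m. ?f i) = (\<Sum>i<m. \<beta> i * indicator (I i) e) / x $ e"
    unfolding sum_divide_distrib by (rule sum.cong) (auto simp: indicator_def)
  ultimately have total: "(\<Sum>i<m. ?f i) = 1"
    using assms(2) by simp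
  have "(\<integral>\<^sup>+ i. ennreal (?f i) \<partial>count_space UNIV) = (\<integral>\<^sup>+ i. ennreal (?f i) \<partial>count_space {..<m})"
    by (subst nn_integral_count_space_indicator) (auto intro!: nn_integral_cong simp: indicator_def)
  also have "\<dots> = ennreal (\<Sum>i<m. ?f i)"
    by (subst nn_integral_count_space_finite) (simp_all only: finite_lessThan sum_ennreal[OF nonneg])
  finally show ?thesis
    unfolding controller_pmf_def using nonneg total by (subst pmf_embed_pmf) (simp_all only: ennreal_1)
qed

text \<open>
  The elements with \<open>x $ e = 0\<close> have no controller. They are almost surely not in \<open>R\<close>, so the
  default index \<open>0\<close> they receive here does not affect the output.
\<close>

definition controllers_pmf ::
  "'a::finite set \<Rightarrow> real ^ 'a \<Rightarrow> nat \<Rightarrow> (nat \<Rightarrow> real) \<Rightarrow> (nat \<Rightarrow> 'a set) \<Rightarrow> ('a \<Rightarrow> nat) pmf" where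
  "controllers_pmf U x m \<beta> I = Pi_pmf {e \<in> U. x $ e > 0} 0 (controller_pmf x m \<beta> I)"

definition random_subset_pmf :: "'a::finite set \<Rightarrow> real ^ 'a \<Rightarrow> 'a set pmf" where
  "random_subset_pmf U x =
     map_pmf (\<lambda>b. {e \<in> U. b e}) (Pi_pmf U False (\<lambda>e. bernoulli_pmf (x $ e)))"

definition delete_opt :: "'a set \<Rightarrow> 'a option \<Rightarrow> 'a set" where
  "delete_opt J y = (case y of None \<Rightarrow> J | Some f \<Rightarrow> J - {f})"

text \<open>The state consists of the history, the current sets \<open>I\<close>, and the set \<open>S\<close>.\<close>

type_synonym 'a aw_state = "'a history \<times> (nat \<Rightarrow> 'a set) \<times> 'a set"

definition aw_step ::
  "nat \<Rightarrow> (nat \<Rightarrow> real) \<Rightarrow> 'a exchange_rule \<Rightarrow> 'a set \<Rightarrow> ('a \<Rightarrow> nat) \<Rightarrow> 'a \<Rightarrow> 'a aw_state \<Rightarrow> 'a aw_state"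
  where
  "aw_step m \<beta> \<Phi> R c e = (\<lambda>(h, I, S).
     let h' = h @ [(e, e \<in> R, c e)] in
     if e \<in> R \<and> e \<in> I (c e)
     then (h',
           \<lambda>j. if j < m \<and> \<beta> j \<noteq> 0 then insert e (delete_opt (I j) (\<Phi> h I (c e) j e)) else I j,
           insert e S)
     else (h', I, S))"

definition aw_output ::
  "nat \<Rightarrow> (nat \<Rightarrow> real) \<Rightarrow> (nat \<Rightarrow> 'a set) \<Rightarrow> 'a exchange_rule \<Rightarrow> 'a list \<Rightarrow> 'a set \<Rightarrow> ('a \<Rightarrow> nat) \<Rightarrow> 'a set"
  where
  "aw_output m \<beta> I \<Phi> \<sigma> R c = snd (snd (fold (aw_step m \<beta> \<Phi> R c) \<sigma> ([], I, {})))"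

text \<open>
  The matroids are indexed by \<open>j < k\<close>. They share the order \<open>\<sigma>\<close> and the set \<open>R\<close>. The controllers
  \<open>C j\<close> are drawn independently for the different matroids.
\<close>

definition k_aw_scheme ::
  "'a::finite set \<Rightarrow> real ^ 'a \<Rightarrow> nat \<Rightarrow> (nat \<Rightarrow> nat) \<Rightarrow> (nat \<Rightarrow> nat \<Rightarrow> real) \<Rightarrow>
   (nat \<Rightarrow> nat \<Rightarrow> 'a set) \<Rightarrow> (nat \<Rightarrow> 'a exchange_rule) \<Rightarrow> 'a set pmf"
  where
  "k_aw_scheme U x k m \<beta> I \<Phi> =
     do {
       \<sigma> \<leftarrow> pmf_of_set (permutations_of_set U);
       R \<leftarrow> random_subset_pmf U x;
       C \<leftarrow> Pi_pmf {..<k} (\<lambda>_. 0) (\<lambda>j. controllers_pmf U x (m j) (\<beta> j) (I j));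
       return_pmf (\<Inter>j\<in>{..<k}. aw_output (m j) (\<beta> j) (I j) (\<Phi> j) \<sigma> R (C j))
     }"

end

theory Submission
  imports Defs
begin

text \<open>
  Reveal the randomness lazily: in each step a uniformly random unprocessed element \<open>e\<close>, whether
  \<open>e \<in> R\<close>, and its controllers. Let \<open>W\<close> be the sum, over the unprocessed \<open>f\<close>, of \<open>a f * x f\<close> times
  the conditional probability that all (still unrevealed) controllers of \<open>f\<close> have \<open>f\<close> in their
  current sets. With \<open>N\<close> unprocessed elements, one step increases \<open>a(S)\<close> by \<open>W / N\<close> in expectation
  and by at most 1, and decreases \<open>W\<close> by at most \<open>(k + 1) W / N\<close> in expectation and by at most \<open>k + 1\<close>:
  in each matroid an element of a set is evicted by at most one element per controller index. Hence
  \<open>(1 - s)\<close> to the power \<open>a(S)\<close> times \<open>(1 + s)\<close> to the power \<open>- W / (k + 1)\<close> is a supermartingale for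
  \<open>0 \<le> s < 1\<close>. Comparing its first and last values and applying Markov's inequality with
  \<open>s = 1/2\<close> gives a bound that is stronger than the claimed one.
\<close>

section \<open>Elementary inequalities\<close>

text \<open>Bernoulli's inequality for real exponents, obtained as weighted AM-GM of
  \<open>1 + t\<close> and \<open>1\<close>.\<close>

lemma one_plus_powr_le:
  fixes t u :: real
  assumes "-1 < t" "0 \<le> u" "u \<le> 1"
  shows "(1 + t) powr u \<le> 1 + t * u"
  using Youngs_inequality_0[of u "1 - u" "1 + t" 1] assms by (simp add: algebra_simps)

text \<open>Bernoulli's inequality bounds both factors of the change; the cross term of their
  product is nonpositive and dropped. The bound is affine in \<open>g\<close> and \<open>l\<close>,
  so only their separate expectations matter later.\<close>

lemma potential_step_bound:
  fixes s A W W' g l K :: real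
  assumes s: "0 \<le> s" "s < 1" and g: "0 \<le> g" "g \<le> 1" and l: "0 \<le> l" "l \<le> K"
    and W': "W - l \<le> W'" and K: "0 < K"
  shows "(1 - s) powr (A + g) * (1 + s) powr (- W' / K) \<le>
    (1 - s) powr A * (1 + s) powr (- W / K) * (1 - s * g + s * (l / K))"
proof -
  have "(1 + s) powr (- W' / K) \<le> (1 + s) powr (- W / K + l / K)"
    using s W' K by (intro powr_mono) (auto simp: field_simps)
  then have "(1 - s) powr (A + g) * (1 + s) powr (- W' / K) \<le>
      (1 - s) powr (A + g) * (1 + s) powr (- W / K + l / K)"
    by (intro mult_left_mono) auto
  also have "\<dots> = (1 - s) powr A * (1 + s) powr (- W / K) *
      ((1 - s) powr g * (1 + s) powr (l / K))"
    unfolding powr_add by (simp add: mult_ac)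
  also have "(1 - s) powr g * (1 + s) powr (l / K) \<le> (1 - s * g) * (1 + s * (l / K))"
    using one_plus_powr_le[of "-s" g] one_plus_powr_le[of s "l / K"] s g l K
    by (intro mult_mono) (auto simp: mult_le_one)
  also have "\<dots> = 1 - s * g + s * (l / K) - s * g * (s * (l / K))"
    by (simp add: algebra_simps flip: add_divide_distrib)
  also have "\<dots> \<le> 1 - s * g + s * (l / K)"
    using s g l K by simp
  finally show ?thesis
    using s by (simp add: mult_left_mono)
qed

text \<open>Linearizes the drop of a product over the matroids, so that correlations between losses
  in different matroids become irrelevant.\<close>

lemma prod_diff_ge:
  fixes y r :: "'b \<Rightarrow> real"
  assumes "finite J" "\<And>j. j \<in> J \<Longrightarrow> 0 \<le> r j \<and> r j \<le> y j"
  shows "(\<Prod>j\<in>J. y j) - (\<Sum>j\<in>J. (\<Prod>j'\<in>J - {j}. y j') * r j) \<le> (\<Prod>j\<in>J. y j - r j)"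
  using assms
proof (induction J rule: finite_induct)
  case (insert b J)
  have "(\<Prod>j'\<in>insert b J - {j}. y j') = y b * (\<Prod>j'\<in>J - {j}. y j')" if "j \<in> J" for j
  proof -
    have "insert b J - {j} = insert b (J - {j})" using insert that by auto
    then show ?thesis using insert by simp
  qed
  then have "(\<Sum>j\<in>J. (\<Prod>j'\<in>insert b J - {j}. y j') * r j) =
      y b * (\<Sum>j\<in>J. (\<Prod>j'\<in>J - {j}. y j') * r j)"
    by (simp add: sum_distrib_left mult_ac)
  moreover have "insert b J - {b} = J" using insert by auto
  ultimately have "(\<Prod>j\<in>insert b J. y j) - (\<Sum>j\<in>insert b J. (\<Prod>j'\<in>insert b J - {j}. y j') * r j)
      = y b * ((\<Prod>j\<in>J. y j) - (\<Sum>j\<in>J. (\<Prod>j'\<in>J - {j}. y j') * r j)) - r b * (\<Prod>j\<in>J. y j)"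
    using insert by (simp add: algebra_simps)
  also have "\<dots> \<le> y b * (\<Prod>j\<in>J. y j - r j) - r b * (\<Prod>j\<in>J. y j - r j)"
  proof (rule diff_mono)
    show "y b * ((\<Prod>j\<in>J. y j) - (\<Sum>j\<in>J. (\<Prod>j'\<in>J - {j}. y j') * r j)) \<le> y b * (\<Prod>j\<in>J. y j - r j)"
      using insert.IH insert.prems[of b] insert.prems by (intro mult_left_mono) (auto intro: order_trans)
    show "r b * (\<Prod>j\<in>J. y j - r j) \<le> r b * (\<Prod>j\<in>J. y j)"
      using insert.prems by (intro mult_left_mono prod_mono) auto
  qed
  also have "\<dots> = (\<Prod>j\<in>insert b J. y j - r j)"
    using insert by (simp add: algebra_simps)
  finally show ?case .
qed simp

lemma expectation_pair_bernoulli_pmf: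
  fixes f :: "bool \<times> 'b \<Rightarrow> real"
  assumes "finite (set_pmf P)" "0 \<le> p" "p \<le> 1"
  shows "measure_pmf.expectation (pair_pmf (bernoulli_pmf p) P) f =
    p * measure_pmf.expectation P (\<lambda>y. f (True, y)) + (1 - p) * measure_pmf.expectation P (\<lambda>y. f (False, y))"
proof -
  have "measure_pmf.expectation (pair_pmf (bernoulli_pmf p) P) f =
      measure_pmf.expectation (bernoulli_pmf p \<bind> (\<lambda>b. map_pmf (Pair b) P)) f"
    by (simp add: pair_pmf_def map_pmf_def)
  also have "\<dots> = (\<Sum>b\<in>UNIV. pmf (bernoulli_pmf p) b *\<^sub>R measure_pmf.expectation (map_pmf (Pair b) P) f)"
    using assms by (intro pmf_expectation_bind) auto
  also have "\<dots> = p * measure_pmf.expectation P (\<lambda>y. f (True, y)) + (1 - p) * measure_pmf.expectation P (\<lambda>y. f (False, y))"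
    using assms by (simp add: UNIV_bool)
  finally show ?thesis .
qed

lemma sum_of_bool_le_1:
  assumes "finite A" "\<And>e e'. e \<in> A \<Longrightarrow> e' \<in> A \<Longrightarrow> P e \<Longrightarrow> P e' \<Longrightarrow> e = e'"
  shows "(\<Sum>e\<in>A. of_bool (P e) :: real) \<le> 1"
proof -
  have "(\<Sum>e\<in>A. of_bool (P e) :: real) = real (card {e \<in> A. P e})"
    using assms(1) by (simp add: of_bool_def sum.If_cases Int_def)
  also have "card {e \<in> A. P e} \<le> 1"
    using assms by (subst One_nat_def, subst card_le_Suc0_iff_eq) auto
  finally show ?thesis by simp
qed

section \<open>The scheme started from an arbitrary state\<close>

locale k_aw =
  fixes U :: "'a::finite set"
    and k :: nat
    and Ind :: "nat \<Rightarrow> 'a set set"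
    and x :: "real ^ 'a"
    and m :: "nat \<Rightarrow> nat"
    and \<beta> :: "nat \<Rightarrow> nat \<Rightarrow> real"
    and I0 :: "nat \<Rightarrow> nat \<Rightarrow> 'a set"
    and \<Phi> :: "nat \<Rightarrow> 'a exchange_rule"
    and a :: "'a \<Rightarrow> real"
  assumes k_pos: "1 \<le> k"
    and decomposition: "\<And>j. j < k \<Longrightarrow> convex_decomposition U (Ind j) x (m j) (\<beta> j) (I0 j)"
    and valid_rule: "\<And>j. j < k \<Longrightarrow> valid_exchange_rule (Ind j) (m j) (\<Phi> j)"
    and a_bounds: "\<And>e. e \<in> U \<Longrightarrow> a e \<in> {0..1}"
begin

text \<open>Indicators must stay factors of the summands: such sums are compared termwise and
  swapped below.\<close>

declare sum_mult_of_bool_eq [simp del] sum_of_bool_mult_eq [simp del]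

text \<open>For \<open>x $ e = 0\<close> this is the default of \<open>Pi_pmf\<close> in
  \<open>controllers_pmf\<close>, so the controllers form a product over all elements.\<close>

definition ctl :: "nat \<Rightarrow> 'a \<Rightarrow> nat pmf" where
  "ctl j e = (if x $ e > 0 then controller_pmf x (m j) (\<beta> j) (I0 j) e else return_pmf 0)"

text \<open>A step reads \<open>R\<close> and the controllers only at \<open>e\<close>, so one bit
  and one index suffice.\<close>

definition step :: "nat \<Rightarrow> 'a \<Rightarrow> bool \<Rightarrow> nat \<Rightarrow> 'a aw_state \<Rightarrow> 'a aw_state" where
  "step j e b i = aw_step (m j) (\<beta> j) (\<Phi> j) (if b then {e} else {}) (\<lambda>_. i) e"

definition outcome ::
  "'a list \<Rightarrow> 'a set \<Rightarrow> (nat \<Rightarrow> 'a \<Rightarrow> nat) \<Rightarrow> (nat \<Rightarrow> 'a aw_state) \<Rightarrow> 'a set" where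
  "outcome \<sigma> R C st =
     (\<Inter>j\<in>{..<k}. snd (snd (fold (aw_step (m j) (\<beta> j) (\<Phi> j) R (C j)) \<sigma> (st j))))"

text \<open>The set \<open>V\<close> of unprocessed elements and the current states are arbitrary,
  as the induction on \<open>card V\<close> requires.\<close>

definition run :: "'a set \<Rightarrow> (nat \<Rightarrow> 'a aw_state) \<Rightarrow> 'a set pmf" where
  "run V st =
     do {
       \<sigma> \<leftarrow> pmf_of_set (permutations_of_set V);
       R \<leftarrow> random_subset_pmf V x;
       C \<leftarrow> Pi_pmf {..<k} (\<lambda>_. 0) (\<lambda>j. controllers_pmf V x (m j) (\<beta> j) (I0 j));
       return_pmf (outcome \<sigma> R C st)
     }"

definition reveal :: "'a \<Rightarrow> (bool \<times> (nat \<Rightarrow> nat)) pmf" where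
  "reveal e = pair_pmf (bernoulli_pmf (x $ e)) (Pi_pmf {..<k} 0 (\<lambda>j. ctl j e))"

definition next_st ::
  "(nat \<Rightarrow> 'a aw_state) \<Rightarrow> 'a \<Rightarrow> bool \<times> (nat \<Rightarrow> nat) \<Rightarrow> nat \<Rightarrow> 'a aw_state" where
  "next_st st e = (\<lambda>(b, i) j. step j e b (i j) (st j))"

section \<open>Lazy revelation of the randomness\<close>

lemma k_aw_scheme_eq_run: "k_aw_scheme U x k m \<beta> I0 \<Phi> = run U (\<lambda>j. ([], I0 j, {}))"
  by (simp add: k_aw_scheme_def run_def outcome_def aw_output_def)

lemma aw_step_eq_step: "aw_step (m j) (\<beta> j) (\<Phi> j) R c e = step j e (e \<in> R) (c e)"
  by (rule ext) (auto simp: aw_step_def step_def Let_def)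

text \<open>The data of \<open>e\<close> is read only when \<open>e\<close> is processed, so the
  rest of the run does not see it.\<close>

lemma outcome_Cons:
  assumes "e \<notin> set \<sigma>" "e \<notin> R"
  shows "outcome (e # \<sigma>) (if b then insert e R else R) (\<lambda>j. if j < k then (C j)(e := i j) else D) st =
    outcome \<sigma> R C (next_st st e (b, i))"
proof -
  have "fold (aw_step (m j) (\<beta> j) (\<Phi> j) (if b then insert e R else R) ((C j)(e := i j))) \<sigma> s =
        fold (aw_step (m j) (\<beta> j) (\<Phi> j) R (C j)) \<sigma> s" for j s
    using assms by (intro fold_cong refl) (auto simp: aw_step_eq_step)
  then show ?thesis
    using assms unfolding outcome_def next_st_def
    by (intro INF_cong refl) (auto simp: aw_step_eq_step)
qed

lemma random_subset_pmf_insert: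
  assumes "e \<notin> V"
  shows "random_subset_pmf (insert e V) x =
    do {
      b \<leftarrow> bernoulli_pmf (x $ e);
      R \<leftarrow> random_subset_pmf V x;
      return_pmf (if b then insert e R else R)
    }"
  using assms unfolding random_subset_pmf_def
  by (simp add: Pi_pmf_insert' map_bind_pmf bind_map_pmf)
    (intro bind_pmf_cong refl arg_cong[of _ _ return_pmf], auto)

lemma controllers_pmf_eq_Pi_pmf: "controllers_pmf V x (m j) (\<beta> j) (I0 j) = Pi_pmf V 0 (ctl j)"
  unfolding controllers_pmf_def ctl_def by (simp add: Pi_pmf_if_set)

lemma controllers_pmf_insert:
  assumes "e \<notin> V"
  shows "Pi_pmf {..<k} (\<lambda>_. 0) (\<lambda>j. controllers_pmf (insert e V) x (m j) (\<beta> j) (I0 j)) =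
    do {
      i \<leftarrow> Pi_pmf {..<k} 0 (\<lambda>j. ctl j e);
      C \<leftarrow> Pi_pmf {..<k} (\<lambda>_. 0) (\<lambda>j. controllers_pmf V x (m j) (\<beta> j) (I0 j));
      return_pmf (\<lambda>j. if j < k then (C j)(e := i j) else (\<lambda>_. 0))
    }"
  using assms unfolding controllers_pmf_eq_Pi_pmf
  by (simp add: Pi_pmf_insert' Pi_pmf_bind[where d' = 0] Pi_pmf_bind[where d' = "\<lambda>_. 0"])

lemma run_empty: "run {} st = return_pmf (\<Inter>j\<in>{..<k}. snd (snd (st j)))"
  by (simp add: run_def random_subset_pmf_def controllers_pmf_def outcome_def pmf_of_set_singleton
      bind_return_pmf bind_map_pmf)

text \<open>A uniform order is a uniform first element followed by a uniform order of the rest, and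
  the product distributions split off the data of \<open>e\<close>.\<close>

lemma run_step:
  assumes "V \<noteq> {}"
  shows "run V st =
    do {
      e \<leftarrow> pmf_of_set V;
      \<omega> \<leftarrow> reveal e;
      run (V - {e}) (next_st st e \<omega>)
    }"
proof -
  let ?R = "\<lambda>V. random_subset_pmf V x"
  let ?C = "\<lambda>V. Pi_pmf {..<k} (\<lambda>_. 0) (\<lambda>j. controllers_pmf V x (m j) (\<beta> j) (I0 j))"
  let ?P = "\<lambda>V. pmf_of_set (permutations_of_set V)"
  have "run V st = do { e \<leftarrow> pmf_of_set V; \<sigma> \<leftarrow> ?P (V - {e}); R \<leftarrow> ?R V; C \<leftarrow> ?C V;
      return_pmf (outcome (e # \<sigma>) R C st) }"
    unfolding run_def using assms
    by (subst random_permutation_of_set) (simp_all add: bind_assoc_pmf bind_return_pmf)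
  also have "\<dots> = do { e \<leftarrow> pmf_of_set V; \<omega> \<leftarrow> reveal e; run (V - {e}) (next_st st e \<omega>) }"
  proof (rule bind_pmf_cong[OF refl])
    fix e assume "e \<in> set_pmf (pmf_of_set V)"
    then have e: "e \<in> V" using assms by simp
    define V' where "V' = V - {e}"
    have V: "V = insert e V'" "e \<notin> V'" using e by (auto simp: V'_def)
    have "do { \<sigma> \<leftarrow> ?P V'; R \<leftarrow> ?R V; C \<leftarrow> ?C V; return_pmf (outcome (e # \<sigma>) R C st) } =
      do { \<sigma> \<leftarrow> ?P V'; b \<leftarrow> bernoulli_pmf (x $ e); R \<leftarrow> ?R V';
           i \<leftarrow> Pi_pmf {..<k} 0 (\<lambda>j. ctl j e); C \<leftarrow> ?C V';
           return_pmf (outcome (e # \<sigma>) (if b then insert e R else R)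
             (\<lambda>j. if j < k then (C j)(e := i j) else (\<lambda>_. 0)) st) }"
      using V(2) unfolding V(1)
      by (simp add: random_subset_pmf_insert controllers_pmf_insert bind_assoc_pmf bind_return_pmf)
    also have "\<dots> = do { \<sigma> \<leftarrow> ?P V'; b \<leftarrow> bernoulli_pmf (x $ e); R \<leftarrow> ?R V';
           i \<leftarrow> Pi_pmf {..<k} 0 (\<lambda>j. ctl j e); C \<leftarrow> ?C V';
           return_pmf (outcome \<sigma> R C (next_st st e (b, i))) }"
      using V(2)
      by (intro bind_pmf_cong refl arg_cong[of _ _ return_pmf] outcome_Cons)
        (auto simp: random_subset_pmf_def dest: permutations_of_setD)
    also have "\<dots> = do { b \<leftarrow> bernoulli_pmf (x $ e); i \<leftarrow> Pi_pmf {..<k} 0 (\<lambda>j. ctl j e);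
           \<sigma> \<leftarrow> ?P V'; R \<leftarrow> ?R V'; C \<leftarrow> ?C V';
           return_pmf (outcome \<sigma> R C (next_st st e (b, i))) }"
      \<comment> \<open>Independent draws commute: the bit and the controllers of \<open>e\<close>
        move to the front.\<close>
      apply (subst bind_commute_pmf[of "?P V'"])
      apply (subst bind_commute_pmf[of "?R V'" "Pi_pmf {..<k} 0 (\<lambda>j. ctl j e)"])
      apply (subst bind_commute_pmf[of "?P V'" "Pi_pmf {..<k} 0 (\<lambda>j. ctl j e)"])
      by (rule refl)
    also have "\<dots> = do { \<omega> \<leftarrow> reveal e; run V' (next_st st e \<omega>) }"
      by (simp add: reveal_def pair_pmf_def run_def bind_assoc_pmf bind_return_pmf)
    finally show "do { \<sigma> \<leftarrow> ?P (V - {e}); R \<leftarrow> ?R V; C \<leftarrow> ?C V;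
      return_pmf (outcome (e # \<sigma>) R C st) } =
      do { \<omega> \<leftarrow> reveal e; run (V - {e}) (next_st st e \<omega>) }"
      unfolding V'_def .
  qed
  finally show ?thesis .
qed

section \<open>Controllers and survival probabilities\<close>

text \<open>The probability that the set of an unrevealed controller still contains \<open>f\<close>, and the part of it
  that is lost when the sets \<open>K\<close> are replaced by \<open>K'\<close>.\<close>

definition alive :: "nat \<Rightarrow> (nat \<Rightarrow> 'a set) \<Rightarrow> 'a \<Rightarrow> real" where
  "alive j K f = (\<Sum>i<m j. pmf (ctl j f) i * of_bool (f \<in> K i))"

definition lost :: "nat \<Rightarrow> (nat \<Rightarrow> 'a set) \<Rightarrow> (nat \<Rightarrow> 'a set) \<Rightarrow> 'a \<Rightarrow> real" where
  "lost j K K' f = (\<Sum>i<m j. pmf (ctl j f) i * of_bool (f \<in> K i - K' i))"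

abbreviation sets_of :: "'a aw_state \<Rightarrow> nat \<Rightarrow> 'a set" where
  "sets_of s \<equiv> fst (snd s)"

lemma x_eq: "j < k \<Longrightarrow> x $ f = (\<Sum>i<m j. \<beta> j i * of_bool (f \<in> I0 j i))"
  using decomposition[of j] by (auto simp: convex_decomposition_def indicator_vec_def indicator_def intro!: sum.cong)

lemma weight_nonneg: "j < k \<Longrightarrow> i < m j \<Longrightarrow> 0 \<le> \<beta> j i"
  and weight_sum: "j < k \<Longrightarrow> (\<Sum>i<m j. \<beta> j i) = 1"
  using decomposition[of j] by (auto simp: convex_decomposition_def)

lemma x_nonneg: "0 \<le> x $ f"
  using k_pos by (subst x_eq[of 0]) (auto intro!: sum_nonneg weight_nonneg)

lemma x_le_1: "x $ f \<le> 1"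
proof -
  have "x $ f \<le> (\<Sum>i<m 0. \<beta> 0 i)"
    using k_pos by (subst x_eq[of 0]) (auto intro!: sum_mono weight_nonneg)
  then show ?thesis using k_pos weight_sum[of 0] by simp
qed

lemma pmf_ctl_pos:
  assumes "j < k" "x $ f > 0"
  shows "pmf (ctl j f) i = (if i < m j \<and> \<beta> j i \<noteq> 0 \<and> f \<in> I0 j i then \<beta> j i / x $ f else 0)"
  using pmf_controller_pmf[OF decomposition[OF assms(1)] assms(2)] assms by (simp add: ctl_def)

lemma set_ctl:
  assumes "j < k"
  shows "set_pmf (ctl j f) \<subseteq> {..<m j}"
proof (cases "x $ f > 0")
  case True
  then show ?thesis
    using assms by (auto simp: set_pmf_eq pmf_ctl_pos split: if_splits)
next
  case False
  \<comment> \<open>The default index \<open>0\<close> is legal because the weights sum to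
    1.\<close>
  have "m j \<noteq> 0" using weight_sum[OF assms] by (intro notI) simp
  with False show ?thesis by (simp add: ctl_def)
qed

lemma sum_pmf_ctl: "j < k \<Longrightarrow> (\<Sum>i<m j. pmf (ctl j f) i) = 1"
  using set_ctl[of j f] by (intro sum_pmf_eq_1) auto

text \<open>The factor \<open>x $ f\<close> cancels the normalization of the controller probability.
  The bound no longer depends on \<open>f\<close>, so sums over elements can be swapped with sums
  over indices.\<close>

lemma x_mult_pmf_ctl_le:
  assumes "j < k" "i < m j"
  shows "x $ f * pmf (ctl j f) i \<le> \<beta> j i"
proof (cases "x $ f > 0")
  case True
  then show ?thesis using assms weight_nonneg by (simp add: pmf_ctl_pos)
next
  case False
  then show ?thesis using x_nonneg[of f] weight_nonneg[OF assms] by (simp add: order.antisym not_less)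
qed

lemma alive_nonneg: "0 \<le> alive j K f"
  by (auto simp: alive_def intro!: sum_nonneg)

lemma alive_le_1: "j < k \<Longrightarrow> alive j K f \<le> 1"
  unfolding alive_def by (subst sum_pmf_ctl[of j f, symmetric]) (auto intro!: sum_mono)

lemma lost_nonneg: "0 \<le> lost j K K' f"
  by (auto simp: lost_def intro!: sum_nonneg)

lemma lost_le_alive: "lost j K K' f \<le> alive j K f"
  unfolding alive_def lost_def by (auto intro!: sum_mono)

text \<open>Only an inequality, since \<open>K'\<close> may contain \<open>f\<close> where
  \<open>K\<close> does not.\<close>

lemma alive_diff_lost: "alive j K f - lost j K K' f \<le> alive j K' f"
  unfolding alive_def lost_def sum_subtractf[symmetric] by (auto intro!: sum_mono)

lemma lost_same [simp]: "lost j K K f = 0"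
  by (simp add: lost_def)

text \<open>Controllers are drawn among the initial sets that contain \<open>f\<close>.\<close>

lemma alive_initial:
  assumes "j < k" "x $ f > 0"
  shows "alive j (I0 j) f = 1"
proof -
  have "alive j (I0 j) f = (\<Sum>i<m j. pmf (ctl j f) i)"
    unfolding alive_def using assms by (intro sum.cong) (auto simp: pmf_ctl_pos)
  then show ?thesis using assms by (simp add: sum_pmf_ctl)
qed

section \<open>The effect of one step within one matroid\<close>

text \<open>Underlies both counting bounds below: \<open>e\<close> determines the evicted
  \<open>f\<close>, and injectivity of the exchange mapping bounds the number of \<open>e\<close>
  that can evict a given \<open>f\<close>.\<close>

lemma step_removed:
  assumes "f \<in> sets_of s l - sets_of (step j e b i s) l"
  shows "b \<and> e \<in> sets_of s i \<and> \<Phi> j (fst s) (sets_of s) i l e = Some f"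
  using assms
  by (auto simp: step_def aw_step_def Let_def case_prod_unfold delete_opt_def split: if_splits option.splits)

lemma step_False [simp]: "sets_of (step j e False i s) = sets_of s"
  by (simp add: step_def aw_step_def Let_def case_prod_unfold)

text \<open>Keeps the hypothesis of \<open>valid_exchange_rule\<close> true for the current
  sets.\<close>

lemma step_indep:
  assumes "j < k" "\<forall>l<m j. sets_of s l \<in> Ind j" "i < m j"
  shows "\<forall>l<m j. sets_of (step j e b i s) l \<in> Ind j"
proof (intro allI impI)
  fix l assume l: "l < m j"
  let ?\<phi> = "\<Phi> j (fst s) (sets_of s) i l"
  have ex: "exchange_mapping (Ind j) (sets_of s i) (sets_of s l) ?\<phi>"
    using valid_rule[OF assms(1)] assms l by (auto simp: valid_exchange_rule_def)
  show "sets_of (step j e b i s) l \<in> Ind j"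
  proof (cases "b \<and> e \<in> sets_of s i \<and> \<beta> j l \<noteq> 0")
    case True
    then have eq: "sets_of (step j e b i s) l = insert e (delete_opt (sets_of s l) (?\<phi> e))"
      using l by (simp add: step_def aw_step_def Let_def case_prod_unfold)
    show ?thesis
    proof (cases "?\<phi> e")
      case None
      then show ?thesis using ex True unfolding eq by (auto simp: exchange_mapping_def delete_opt_def)
    next
      case (Some f)
      then have "f \<in> sets_of s l" "insert e (sets_of s l) - {f} \<in> Ind j"
        using ex True by (auto simp: exchange_mapping_def)
      \<comment> \<open>A step deletes before inserting, an exchange mapping the other way round;
        the results differ only for \<open>e = f\<close>.\<close>
      moreover have "insert e (sets_of s l - {f}) = (if e = f then sets_of s l else insert e (sets_of s l) - {f})"
        using \<open>f \<in> sets_of s l\<close> by auto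
      ultimately show ?thesis using assms l Some unfolding eq by (simp add: delete_opt_def)
    qed
  next
    case False
    then have "sets_of (step j e b i s) l = sets_of s l"
      by (auto simp: step_def aw_step_def Let_def case_prod_unfold)
    then show ?thesis using assms l by simp
  qed
qed

text \<open>Each of the sets loses at most one element in a step, hence the total loss is at most the sum
  of the weights.\<close>

lemma sum_lost_le_1:
  assumes "j < k"
  shows "(\<Sum>f\<in>V. x $ f * lost j (sets_of s) (sets_of (step j e b i s)) f) \<le> 1"
proof -
  let ?K = "sets_of s" and ?K' = "sets_of (step j e b i s)"
  have "(\<Sum>f\<in>V. x $ f * lost j ?K ?K' f) =
      (\<Sum>f\<in>V. \<Sum>l<m j. x $ f * pmf (ctl j f) l * of_bool (f \<in> ?K l - ?K' l))"
    unfolding lost_def by (simp add: sum_distrib_left mult_ac)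
  also have "\<dots> \<le> (\<Sum>f\<in>V. \<Sum>l<m j. \<beta> j l * of_bool (f \<in> ?K l - ?K' l))"
    using assms by (intro sum_mono mult_right_mono x_mult_pmf_ctl_le) auto
  also have "\<dots> = (\<Sum>l<m j. \<beta> j l * (\<Sum>f\<in>V. of_bool (f \<in> ?K l - ?K' l)))"
    by (subst sum.swap) (simp only: sum_distrib_left)
  also have "\<dots> \<le> (\<Sum>l<m j. \<beta> j l * 1)"
  proof (intro sum_mono mult_left_mono sum_of_bool_le_1)
    show "f = f'" if "f \<in> ?K l - ?K' l" "f' \<in> ?K l - ?K' l" for f f' l
      using step_removed[OF that(1)] step_removed[OF that(2)] by simp
  qed (use assms weight_nonneg in auto)
  finally show ?thesis using weight_sum[OF assms] by simp
qed

text \<open>For each pair of sets, at most one element can evict \<open>f\<close>: exchange mappings are injective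
  where they do not take the value \<^const>\<open>None\<close>.\<close>

lemma sum_expected_lost_le:
  assumes "j < k" and indep: "\<forall>l<m j. sets_of s l \<in> Ind j"
  shows "(\<Sum>e\<in>V. x $ e * (\<Sum>i<m j. pmf (ctl j e) i *
    lost j (sets_of s) (sets_of (step j e True i s)) f)) \<le> alive j (sets_of s) f"
proof -
  let ?K = "sets_of s"
  \<comment> \<open>A necessary condition for \<open>e\<close>, controlled by \<open>i\<close>, to
    evict \<open>f\<close> from set \<open>l\<close>.\<close>
  let ?H = "\<lambda>e i l. e \<in> ?K i \<and> f \<in> ?K l \<and> \<Phi> j (fst s) ?K i l e = Some f"
  have lost_le: "lost j ?K (sets_of (step j e True i s)) f \<le> (\<Sum>l<m j. pmf (ctl j f) l * of_bool (?H e i l))" for e i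
    unfolding lost_def
  proof (intro sum_mono mult_left_mono)
    show "of_bool (f \<in> ?K l - sets_of (step j e True i s) l) \<le> (of_bool (?H e i l) :: real)" for l
      using step_removed[of f s l j e True i] by (cases "f \<in> ?K l - sets_of (step j e True i s) l") simp_all
  qed simp
  have "(\<Sum>e\<in>V. x $ e * (\<Sum>i<m j. pmf (ctl j e) i * lost j ?K (sets_of (step j e True i s)) f)) =
      (\<Sum>e\<in>V. \<Sum>i<m j. (x $ e * pmf (ctl j e) i) * lost j ?K (sets_of (step j e True i s)) f)"
    by (simp add: sum_distrib_left mult_ac)
  also have "\<dots> \<le> (\<Sum>e\<in>V. \<Sum>i<m j. \<beta> j i * (\<Sum>l<m j. pmf (ctl j f) l * of_bool (?H e i l)))"
    using assms by (intro sum_mono mult_mono x_mult_pmf_ctl_le lost_le) (auto intro: weight_nonneg lost_nonneg)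
  \<comment> \<open>The sum over \<open>e\<close> becomes innermost, to count the evictors of
    \<open>f\<close> for each pair \<open>(i, l)\<close>.\<close>
  also have "\<dots> = (\<Sum>l<m j. \<Sum>i<m j. \<Sum>e\<in>V. \<beta> j i * (pmf (ctl j f) l * of_bool (?H e i l)))"
    unfolding sum_distrib_left
    by (rule trans[OF sum.cong[OF refl sum.swap] trans[OF sum.swap sum.cong[OF refl sum.swap]]])
  also have "\<dots> = (\<Sum>l<m j. pmf (ctl j f) l * (\<Sum>i<m j. \<beta> j i * (\<Sum>e\<in>V. of_bool (?H e i l))))"
    by (simp only: sum_distrib_left mult_ac)
  also have "\<dots> \<le> (\<Sum>l<m j. pmf (ctl j f) l * (\<Sum>i<m j. \<beta> j i * of_bool (f \<in> ?K l)))"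
  proof (intro sum_mono mult_left_mono)
    fix l i assume li: "l \<in> {..<m j}" "i \<in> {..<m j}"
    then have "exchange_mapping (Ind j) (?K i) (?K l) (\<Phi> j (fst s) ?K i l)"
      using valid_rule[OF assms(1)] indep by (auto simp: valid_exchange_rule_def)
    then have "(\<Sum>e\<in>V. of_bool (e \<in> ?K i \<and> \<Phi> j (fst s) ?K i l e = Some f) :: real) \<le> 1" if "f \<in> ?K l"
      using that by (intro sum_of_bool_le_1) (auto simp: exchange_mapping_def)
    then show "(\<Sum>e\<in>V. of_bool (?H e i l) :: real) \<le> of_bool (f \<in> ?K l)"
      by (cases "f \<in> ?K l") auto
  qed (use assms weight_nonneg in auto)
  also have "\<dots> = alive j ?K f"
    unfolding alive_def using weight_sum[OF assms(1)] by (simp flip: sum_distrib_right)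
  finally show ?thesis .
qed

section \<open>Expectations over the data of one element\<close>

lemma finite_set_controllers: "finite (set_pmf (Pi_pmf {..<k} 0 (\<lambda>j. ctl j e)))"
  by (subst set_Pi_pmf) (auto intro!: finite_PiE_dflt intro: finite_subset[OF set_ctl])

lemma finite_set_reveal: "finite (set_pmf (reveal e))"
  using finite_set_controllers[of e] by (simp add: reveal_def)

lemma integrable_reveal [simp]: "integrable (measure_pmf (reveal e)) (f :: _ \<Rightarrow> real)"
  by (rule integrable_measure_pmf_finite[OF finite_set_reveal])

lemma expectation_reveal:
  fixes f :: "bool \<times> (nat \<Rightarrow> nat) \<Rightarrow> real"
  shows "measure_pmf.expectation (reveal e) f =
    x $ e * measure_pmf.expectation (Pi_pmf {..<k} 0 (\<lambda>j. ctl j e)) (\<lambda>i. f (True, i)) +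
    (1 - x $ e) * measure_pmf.expectation (Pi_pmf {..<k} 0 (\<lambda>j. ctl j e)) (\<lambda>i. f (False, i))"
  unfolding reveal_def
  by (intro expectation_pair_bernoulli_pmf x_nonneg x_le_1 finite_set_controllers)

lemma expectation_ctl:
  "j < k \<Longrightarrow> measure_pmf.expectation (ctl j e) f = (\<Sum>i<m j. pmf (ctl j e) i * (f i :: real))"
  using set_ctl[of j e] by (subst integral_measure_pmf[of "{..<m j}"]) auto

lemma expectation_controller:
  assumes "j < k"
  shows "measure_pmf.expectation (Pi_pmf {..<k} 0 (\<lambda>j. ctl j e)) (\<lambda>i. f (i j)) =
    (\<Sum>i<m j. pmf (ctl j e) i * (f i :: real))"
proof -
  have "measure_pmf.expectation (Pi_pmf {..<k} 0 (\<lambda>j. ctl j e)) (\<lambda>i. f (i j)) =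
      measure_pmf.expectation (map_pmf (\<lambda>i. i j) (Pi_pmf {..<k} 0 (\<lambda>j. ctl j e))) f"
    by simp
  also have "map_pmf (\<lambda>i. i j) (Pi_pmf {..<k} 0 (\<lambda>j. ctl j e)) = ctl j e"
    using assms by (subst Pi_pmf_component) auto
  finally show ?thesis using expectation_ctl[OF assms] by simp
qed

section \<open>Gain and loss over all matroids\<close>

text \<open>The expected gain if \<open>f\<close> were processed next; it is a product because the
  controllers for different matroids are independent.\<close>

definition weight :: "(nat \<Rightarrow> 'a aw_state) \<Rightarrow> 'a \<Rightarrow> real" where
  "weight st f = a f * x $ f * (\<Prod>j<k. alive j (sets_of (st j)) f)"

definition gain :: "(nat \<Rightarrow> 'a aw_state) \<Rightarrow> 'a \<Rightarrow> bool \<times> (nat \<Rightarrow> nat) \<Rightarrow> real" where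
  "gain st e = (\<lambda>(b, i). a e * of_bool (b \<and> (\<forall>j<k. e \<in> sets_of (st j) (i j))))"

definition damage ::
  "(nat \<Rightarrow> 'a aw_state) \<Rightarrow> 'a \<Rightarrow> bool \<times> (nat \<Rightarrow> nat) \<Rightarrow> nat \<Rightarrow> 'a \<Rightarrow> real" where
  "damage st e \<omega> j f = lost j (sets_of (st j)) (sets_of (next_st st e \<omega> j)) f"

text \<open>An upper bound for the decrease of the total weight, linear in the damage.\<close>

definition loss ::
  "'a set \<Rightarrow> (nat \<Rightarrow> 'a aw_state) \<Rightarrow> 'a \<Rightarrow> bool \<times> (nat \<Rightarrow> nat) \<Rightarrow> real" where
  "loss V st e \<omega> = weight st e + (\<Sum>f\<in>V - {e}. a f * x $ f *
     (\<Sum>j<k. (\<Prod>j'\<in>{..<k} - {j}. alive j' (sets_of (st j')) f) * damage st e \<omega> j f))"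

text \<open>Independence makes the exchange mappings valid; disjointness from \<open>V\<close> makes
  every accepted element new.\<close>

definition good :: "'a set \<Rightarrow> (nat \<Rightarrow> 'a aw_state) \<Rightarrow> bool" where
  "good V st \<longleftrightarrow> (\<forall>j<k. (\<forall>i<m j. sets_of (st j) i \<in> Ind j) \<and> snd (snd (st j)) \<inter> V = {})"

lemma weight_bounds: "f \<in> U \<Longrightarrow> 0 \<le> weight st f \<and> weight st f \<le> 1"
  unfolding weight_def using a_bounds[of f] x_nonneg[of f] x_le_1[of f]
  by (auto intro!: mult_le_one mult_nonneg_nonneg prod_nonneg prod_le_1 alive_nonneg alive_le_1)

lemma gain_bounds: "e \<in> U \<Longrightarrow> 0 \<le> gain st e \<omega> \<and> gain st e \<omega> \<le> 1"
  using a_bounds[of e] by (auto simp: gain_def case_prod_unfold)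

lemma damage_nonneg: "0 \<le> damage st e \<omega> j f"
  by (simp add: damage_def lost_nonneg)

lemma expectation_gain: "measure_pmf.expectation (reveal e) (gain st e) = weight st e"
proof -
  have "(\<lambda>i. gain st e (True, i)) = (\<lambda>i. a e * (\<Prod>j\<in>{..<k}. of_bool (e \<in> sets_of (st j) (i j))))"
    by (auto simp: gain_def fun_eq_iff of_bool_def intro!: prod.neutral)
  moreover have "measure_pmf.expectation (Pi_pmf {..<k} 0 (\<lambda>j. ctl j e))
      (\<lambda>i. \<Prod>j\<in>{..<k}. of_bool (e \<in> sets_of (st j) (i j))) = (\<Prod>j\<in>{..<k}. alive j (sets_of (st j)) e)"
    by (subst expectation_prod_Pi_pmf)
      (auto simp: expectation_ctl alive_def intro!: prod.cong measure_pmf.integrable_const_bound[of _ 1])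
  ultimately show ?thesis
    by (simp add: expectation_reveal weight_def) (simp add: gain_def)
qed

text \<open>Without \<open>e\<close> in \<open>R\<close> nothing is lost, whence the factor
  \<open>x $ e\<close>; the damage in matroid \<open>j\<close> depends on no controller but the
  \<open>j\<close>-th.\<close>

lemma expectation_damage:
  assumes "j < k"
  shows "measure_pmf.expectation (reveal e) (\<lambda>\<omega>. damage st e \<omega> j f) = x $ e * (\<Sum>i<m j. pmf (ctl j e) i *
    lost j (sets_of (st j)) (sets_of (step j e True i (st j))) f)"
  using expectation_controller[OF assms, of e "\<lambda>i. lost j (sets_of (st j)) (sets_of (step j e True i (st j))) f"]
  by (simp add: expectation_reveal damage_def next_st_def)

text \<open>The processed elements contribute the total weight once. In each of the \<open>k\<close>
  matroids, \<open>sum_expected_lost_le\<close> bounds the expected damage to \<open>f\<close>,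
  summed over \<open>e\<close>, by the factor missing from the product, giving the total weight once
  more.\<close>

lemma expectation_loss_sum:
  assumes "V \<subseteq> U" "good V st"
  shows "(\<Sum>e\<in>V. measure_pmf.expectation (reveal e) (loss V st e)) \<le> (real k + 1) * (\<Sum>f\<in>V. weight st f)"
proof -
  let ?others = "\<lambda>j f. \<Prod>j'\<in>{..<k} - {j}. alive j' (sets_of (st j')) f"
  let ?D = "\<lambda>e j f. measure_pmf.expectation (reveal e) (\<lambda>\<omega>. damage st e \<omega> j f)"
  have D_nonneg: "0 \<le> ?D e j f" for e j f
    by (intro Bochner_Integration.integral_nonneg damage_nonneg)
  have others_nonneg: "0 \<le> ?others j f" for j f
    by (intro prod_nonneg alive_nonneg)
  have ax_nonneg: "0 \<le> a f * x $ f" if "f \<in> V" for f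
    using that assms(1) a_bounds[of f] x_nonneg[of f] by auto
  have term_nonneg: "0 \<le> a f * x $ f * (\<Sum>j<k. ?others j f * ?D e j f)" if "f \<in> V" for e f
    using ax_nonneg[OF that] by (rule mult_nonneg_nonneg)
      (rule sum_nonneg, rule mult_nonneg_nonneg[OF others_nonneg D_nonneg])
  have total: "(\<Sum>e\<in>V. measure_pmf.expectation (reveal e) (loss V st e)) =
      (\<Sum>e\<in>V. weight st e) + (\<Sum>e\<in>V. \<Sum>f\<in>V - {e}. a f * x $ f * (\<Sum>j<k. ?others j f * ?D e j f))"
    unfolding loss_def by (simp add: sum.distrib)
  \<comment> \<open>Adding the nonnegative diagonal terms makes the inner index set independent of
    \<open>e\<close>, so the sums can be swapped.\<close>
  have "(\<Sum>e\<in>V. \<Sum>f\<in>V - {e}. a f * x $ f * (\<Sum>j<k. ?others j f * ?D e j f)) \<le>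
      (\<Sum>e\<in>V. \<Sum>f\<in>V. a f * x $ f * (\<Sum>j<k. ?others j f * ?D e j f))"
    by (rule sum_mono, rule sum_mono2) (auto intro: term_nonneg)
  also have "\<dots> = (\<Sum>f\<in>V. \<Sum>e\<in>V. a f * x $ f * (\<Sum>j<k. ?others j f * ?D e j f))"
    by (rule sum.swap)
  also have "\<dots> = (\<Sum>f\<in>V. a f * x $ f * (\<Sum>j<k. ?others j f * (\<Sum>e\<in>V. ?D e j f)))"
  proof (rule sum.cong[OF refl])
    fix f
    show "(\<Sum>e\<in>V. a f * x $ f * (\<Sum>j<k. ?others j f * ?D e j f)) =
        a f * x $ f * (\<Sum>j<k. ?others j f * (\<Sum>e\<in>V. ?D e j f))"
      unfolding sum_distrib_left[of "?others j f" for j] sum_distrib_left[symmetric, of "a f * x $ f"]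
      by (subst sum.swap) (rule refl)
  qed
  also have "\<dots> \<le> (\<Sum>f\<in>V. a f * x $ f * (\<Sum>j<k. ?others j f * alive j (sets_of (st j)) f))"
  proof (intro sum_mono mult_left_mono)
    fix f j assume "j \<in> {..<k}"
    then show "(\<Sum>e\<in>V. ?D e j f) \<le> alive j (sets_of (st j)) f"
      using assms(2) by (simp add: expectation_damage good_def sum_expected_lost_le)
  qed (use others_nonneg ax_nonneg in auto)
  also have "\<dots> = (\<Sum>f\<in>V. a f * x $ f * (\<Sum>j<k. \<Prod>j'<k. alive j' (sets_of (st j')) f))"
  proof (intro sum.cong refl arg_cong2[of _ _ _ _ "(*)"])
    fix f j assume "j \<in> {..<k}"
    then show "?others j f * alive j (sets_of (st j)) f = (\<Prod>j'<k. alive j' (sets_of (st j')) f)"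
      using prod.remove[of "{..<k}" j "\<lambda>j'. alive j' (sets_of (st j')) f"] by (simp add: mult.commute)
  qed
  also have "\<dots> = real k * (\<Sum>f\<in>V. weight st f)"
    by (simp add: weight_def sum_distrib_left mult_ac)
  finally have "(\<Sum>e\<in>V. \<Sum>f\<in>V - {e}. a f * x $ f * (\<Sum>j<k. ?others j f * ?D e j f)) \<le>
      real k * (\<Sum>f\<in>V. weight st f)" .
  then show ?thesis unfolding total by (simp add: distrib_right)
qed

text \<open>At most 1 for the weight of \<open>e\<close> itself, and at most 1 per matroid by
  \<open>sum_lost_le_1\<close>. The upper bound makes Bernoulli's inequality applicable to
  \<open>l / (k + 1)\<close>.\<close>

lemma loss_bounds:
  assumes "V \<subseteq> U" "e \<in> V"
  shows "0 \<le> loss V st e \<omega> \<and> loss V st e \<omega> \<le> real k + 1"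
proof
  let ?others = "\<lambda>j f. \<Prod>j'\<in>{..<k} - {j}. alive j' (sets_of (st j')) f"
  have others: "0 \<le> ?others j f" "?others j f \<le> 1" for j f
    by (auto intro!: prod_nonneg prod_le_1 alive_nonneg alive_le_1)
  have e: "e \<in> U" using assms by auto
  have a: "f \<in> V - {e} \<Longrightarrow> 0 \<le> a f \<and> a f \<le> 1" for f using a_bounds assms by auto
  show "0 \<le> loss V st e \<omega>"
    unfolding loss_def using weight_bounds[OF e] a
    by (auto intro!: add_nonneg_nonneg sum_nonneg mult_nonneg_nonneg x_nonneg damage_nonneg others)
  have "(\<Sum>f\<in>V - {e}. a f * x $ f * (\<Sum>j<k. ?others j f * damage st e \<omega> j f)) \<le>
      (\<Sum>f\<in>V - {e}. 1 * x $ f * (\<Sum>j<k. 1 * damage st e \<omega> j f))"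
    using a by (intro sum_mono mult_mono mult_right_mono others)
      (auto intro!: mult_nonneg_nonneg sum_nonneg x_nonneg damage_nonneg others)
  also have "\<dots> = (\<Sum>j<k. \<Sum>f\<in>V - {e}. x $ f * damage st e \<omega> j f)"
    by (subst sum.swap) (simp add: sum_distrib_left)
  also have "\<dots> \<le> (\<Sum>j<k. 1)"
    unfolding damage_def next_st_def case_prod_unfold by (intro sum_mono sum_lost_le_1) auto
  finally show "loss V st e \<omega> \<le> real k + 1"
    unfolding loss_def using weight_bounds[OF e, of st] by simp
qed

text \<open>\<open>prod_diff_ge\<close> applies to each remaining \<open>f\<close>; the summand
  \<open>weight st e\<close> of \<open>loss\<close> pays for removing \<open>e\<close> from
  \<open>V\<close>.\<close>

lemma weight_next_ge:
  assumes "V \<subseteq> U" "e \<in> V"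
  shows "(\<Sum>f\<in>V. weight st f) - loss V st e \<omega> \<le> (\<Sum>f\<in>V - {e}. weight (next_st st e \<omega>) f)"
proof -
  have "weight st f - a f * x $ f * (\<Sum>j<k. (\<Prod>j'\<in>{..<k} - {j}. alive j' (sets_of (st j')) f) * damage st e \<omega> j f)
      \<le> weight (next_st st e \<omega>) f" if "f \<in> V - {e}" for f
  proof -
    have "(\<Prod>j<k. alive j (sets_of (st j)) f) -
        (\<Sum>j<k. (\<Prod>j'\<in>{..<k} - {j}. alive j' (sets_of (st j')) f) * damage st e \<omega> j f)
      \<le> (\<Prod>j<k. alive j (sets_of (st j)) f - damage st e \<omega> j f)"
      unfolding damage_def by (intro prod_diff_ge) (auto simp: lost_nonneg lost_le_alive)
    also have "\<dots> \<le> (\<Prod>j<k. alive j (sets_of (next_st st e \<omega> j)) f)"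
      unfolding damage_def by (intro prod_mono) (auto simp: alive_diff_lost lost_le_alive)
    finally have "a f * x $ f * ((\<Prod>j<k. alive j (sets_of (st j)) f) -
        (\<Sum>j<k. (\<Prod>j'\<in>{..<k} - {j}. alive j' (sets_of (st j')) f) * damage st e \<omega> j f)) \<le>
        weight (next_st st e \<omega>) f"
      unfolding weight_def using a_bounds[of f] that assms
      by (intro mult_left_mono mult_nonneg_nonneg x_nonneg) auto
    then show ?thesis by (simp add: weight_def right_diff_distrib)
  qed
  then have "(\<Sum>f\<in>V - {e}. weight st f - a f * x $ f * (\<Sum>j<k. (\<Prod>j'\<in>{..<k} - {j}. alive j' (sets_of (st j')) f) * damage st e \<omega> j f))
      \<le> (\<Sum>f\<in>V - {e}. weight (next_st st e \<omega>) f)"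
    by (rule sum_mono)
  moreover have "(\<Sum>f\<in>V. weight st f) = weight st e + (\<Sum>f\<in>V - {e}. weight st f)"
    using assms by (intro sum.remove) auto
  ultimately show ?thesis by (simp add: loss_def sum_subtractf)
qed

section \<open>Change of the output and preservation of the invariant\<close>

lemma snd_step:
  "snd (snd (step j e b i s)) = (if b \<and> e \<in> sets_of s i then insert e (snd (snd s)) else snd (snd s))"
  by (auto simp: step_def aw_step_def Let_def case_prod_unfold)

lemma sum_next:
  assumes "good V st" "e \<in> V"
  shows "sum a (\<Inter>j\<in>{..<k}. snd (snd (next_st st e \<omega> j))) =
    sum a (\<Inter>j\<in>{..<k}. snd (snd (st j))) + gain st e \<omega>"
proof -
  obtain b i where \<omega>: "\<omega> = (b, i)" by fastforce
  have notin: "e \<notin> snd (snd (st j))" if "j < k" for j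
    using assms that by (auto simp: good_def)
  show ?thesis
  proof (cases "b \<and> (\<forall>j<k. e \<in> sets_of (st j) (i j))")
    case True
    then have "(\<Inter>j\<in>{..<k}. snd (snd (next_st st e \<omega> j))) = insert e (\<Inter>j\<in>{..<k}. snd (snd (st j)))"
      by (auto simp: \<omega> next_st_def snd_step)
    moreover have "e \<notin> (\<Inter>j\<in>{..<k}. snd (snd (st j)))"
      using notin[of 0] k_pos by auto
    ultimately show ?thesis using True by (simp add: gain_def \<omega>)
  next
    case False
    \<comment> \<open>One rejecting matroid keeps \<open>e\<close> out of the intersection, even if
      other matroids accept it.\<close>
    then obtain j0 where j0: "j0 < k" "snd (snd (next_st st e \<omega> j0)) = snd (snd (st j0))"
      using k_pos by (cases b) (auto simp: \<omega> next_st_def snd_step)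
    have "snd (snd (next_st st e \<omega> j)) - {e} = snd (snd (st j)) - {e}" for j
      by (auto simp: \<omega> next_st_def snd_step)
    moreover have "e \<notin> snd (snd (next_st st e \<omega> j0))" "e \<notin> snd (snd (st j0))"
      using j0 notin by auto
    ultimately have "(\<Inter>j\<in>{..<k}. snd (snd (next_st st e \<omega> j))) = (\<Inter>j\<in>{..<k}. snd (snd (st j)))"
      using j0(1) by blast
    then show ?thesis using False by (auto simp: gain_def \<omega>)
  qed
qed

lemma good_next:
  assumes "good V st" "e \<in> V" "\<omega> \<in> set_pmf (reveal e)"
  shows "good (V - {e}) (next_st st e \<omega>)"
proof -
  obtain b i where \<omega>: "\<omega> = (b, i)" by fastforce
  have i: "i j < m j" if "j < k" for j
    using assms(3) set_ctl[OF that, of e] that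
    by (auto simp: \<omega> reveal_def set_Pi_pmf PiE_dflt_def)
  show ?thesis
    using assms(1) step_indep i unfolding good_def \<omega> next_st_def
    by (auto simp: snd_step split: if_splits)
qed

section \<open>The supermartingale\<close>

text \<open>By Bernoulli's inequality, gaining \<open>g \<le> 1\<close> and losing \<open>l \<le> k + 1\<close> in total weight changes
  the potential by a factor at most \<open>1 - s g + s l / (k + 1)\<close>, whose expectation is at most 1.\<close>

lemma potential_bound:
  assumes s: "0 \<le> s" "s < 1" and "V \<subseteq> U" "good V st"
  shows "measure_pmf.expectation (run V st) (\<lambda>S. (1 - s) powr sum a S) \<le>
    (1 - s) powr sum a (\<Inter>j\<in>{..<k}. snd (snd (st j))) * (1 + s) powr (- (\<Sum>f\<in>V. weight st f) / (real k + 1))"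
  using assms(3,4)
proof (induction "card V" arbitrary: V st)
  case 0
  then have "V = {}" by simp
  then show ?case using s by (simp add: run_empty)
next
  case (Suc n)
  let ?K = "real k + 1"
  let ?h = "\<lambda>S. (1 - s) powr sum a S"
  let ?\<Psi> = "\<lambda>V st. (1 - s) powr sum a (\<Inter>j\<in>{..<k}. snd (snd (st j))) * (1 + s) powr (- (\<Sum>f\<in>V. weight st f) / ?K)"
  have V: "V \<noteq> {}" using Suc.hyps by auto
  define N where "N = real (card V)"
  have N: "N > 0" using V by (simp add: N_def card_gt_0_iff)
  \<comment> \<open>With \<open>e\<close> fixed as the next element: the induction hypothesis, then
    the one-step bound, averaged over the revealed data.\<close>
  have step: "measure_pmf.expectation (reveal e \<bind> (\<lambda>\<omega>. run (V - {e}) (next_st st e \<omega>))) ?h \<le>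
      ?\<Psi> V st * (1 - s * measure_pmf.expectation (reveal e) (gain st e) +
        s * (measure_pmf.expectation (reveal e) (loss V st e) / ?K))" if e: "e \<in> V" for e
  proof -
    have "measure_pmf.expectation (reveal e \<bind> (\<lambda>\<omega>. run (V - {e}) (next_st st e \<omega>))) ?h =
        (\<Sum>\<omega>\<in>set_pmf (reveal e). pmf (reveal e) \<omega> *\<^sub>R measure_pmf.expectation (run (V - {e}) (next_st st e \<omega>)) ?h)"
      by (intro pmf_expectation_bind) (auto simp: finite_set_reveal)
    also have "\<dots> \<le> (\<Sum>\<omega>\<in>set_pmf (reveal e). pmf (reveal e) \<omega> *\<^sub>R
        (?\<Psi> V st * (1 - s * gain st e \<omega> + s * (loss V st e \<omega> / ?K))))"
    proof (intro sum_mono scaleR_left_mono)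
      fix \<omega> assume \<omega>: "\<omega> \<in> set_pmf (reveal e)"
      have "measure_pmf.expectation (run (V - {e}) (next_st st e \<omega>)) ?h \<le> ?\<Psi> (V - {e}) (next_st st e \<omega>)"
        using Suc.hyps(2) Suc.prems e \<omega> by (intro Suc.hyps(1) good_next) auto
      also have "\<dots> \<le> ?\<Psi> V st * (1 - s * gain st e \<omega> + s * (loss V st e \<omega> / ?K))"
        unfolding sum_next[OF Suc.prems(2) e]
        using s Suc.prems e gain_bounds[of e st \<omega>] loss_bounds[of V e st \<omega>] weight_next_ge[of V e st \<omega>]
        by (intro potential_step_bound) auto
      finally show "measure_pmf.expectation (run (V - {e}) (next_st st e \<omega>)) ?h \<le>
        ?\<Psi> V st * (1 - s * gain st e \<omega> + s * (loss V st e \<omega> / ?K))" .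
    qed simp
    also have "\<dots> = measure_pmf.expectation (reveal e) (\<lambda>\<omega>. ?\<Psi> V st * (1 - s * gain st e \<omega> + s * (loss V st e \<omega> / ?K)))"
      by (subst integral_measure_pmf[OF finite_set_reveal]) auto
    also have "\<dots> = ?\<Psi> V st * (1 - s * measure_pmf.expectation (reveal e) (gain st e) +
        s * (measure_pmf.expectation (reveal e) (loss V st e) / ?K))"
      by simp
    finally show ?thesis .
  qed
  have "measure_pmf.expectation (run V st) ?h =
      (\<Sum>e\<in>V. measure_pmf.expectation (reveal e \<bind> (\<lambda>\<omega>. run (V - {e}) (next_st st e \<omega>))) ?h /\<^sub>R N)"
    unfolding run_step[OF V] N_def using V by (intro pmf_expectation_bind_pmf_of_set) auto
  also have "\<dots> \<le> (\<Sum>e\<in>V. (?\<Psi> V st * (1 - s * measure_pmf.expectation (reveal e) (gain st e) +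
        s * (measure_pmf.expectation (reveal e) (loss V st e) / ?K))) /\<^sub>R N)"
    using N by (intro sum_mono scaleR_left_mono step) auto
  also have "\<dots> = ?\<Psi> V st / N * (\<Sum>e\<in>V. 1 - s * weight st e +
        s * (measure_pmf.expectation (reveal e) (loss V st e) / ?K))"
    by (simp add: expectation_gain sum_distrib_left divide_inverse mult_ac)
  also have "(\<Sum>e\<in>V. 1 - s * weight st e + s * (measure_pmf.expectation (reveal e) (loss V st e) / ?K)) =
      N - s * (\<Sum>e\<in>V. weight st e) + s * ((\<Sum>e\<in>V. measure_pmf.expectation (reveal e) (loss V st e)) / ?K)"
    by (simp add: sum.distrib sum_subtractf N_def sum_distrib_left sum_divide_distrib)
  also have "?\<Psi> V st / N * \<dots> \<le> ?\<Psi> V st / N * N"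
  proof (rule mult_left_mono)
    \<comment> \<open>Expected loss divided by \<open>k + 1\<close> is at most expected gain, so the
      linear terms cancel in the right direction; this fixes the exponent
      \<open>- W / (k + 1)\<close>.\<close>
    have "(\<Sum>e\<in>V. measure_pmf.expectation (reveal e) (loss V st e)) / ?K \<le> (\<Sum>e\<in>V. weight st e)"
      using expectation_loss_sum[OF Suc.prems] by (simp add: divide_le_eq mult.commute)
    from mult_left_mono[OF this s(1)]
    show "N - s * (\<Sum>e\<in>V. weight st e) + s * ((\<Sum>e\<in>V. measure_pmf.expectation (reveal e) (loss V st e)) / ?K) \<le> N"
      by linarith
  qed (use N in auto)
  also have "\<dots> = ?\<Psi> V st" using N by simp
  finally show ?case .
qed

text \<open>Initially every element with \<open>x $ e > 0\<close> is alive with probability 1, so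
  the total weight is \<open>Q\<close>, while the output is empty.\<close>

lemma exponential_moment:
  assumes "0 \<le> s" "s < 1"
  shows "measure_pmf.expectation (k_aw_scheme U x k m \<beta> I0 \<Phi>) (\<lambda>S. (1 - s) powr sum a S) \<le>
    (1 + s) powr (- (\<Sum>e\<in>U. a e * x $ e) / (real k + 1))"
proof -
  have "weight (\<lambda>j. ([], I0 j, {})) e = a e * x $ e" for e
    using x_nonneg[of e] by (cases "x $ e = 0") (auto simp: weight_def alive_initial)
  moreover have "good U (\<lambda>j. ([], I0 j, {}))"
    using decomposition by (auto simp: good_def convex_decomposition_def)
  \<comment> \<open>For \<open>k = 0\<close> the intersection would be \<open>UNIV\<close>.\<close>
  moreover have "(\<Inter>j\<in>{..<k}. {} :: 'a set) = {}"
    using k_pos by (auto simp: lessThan_empty_iff)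
  ultimately show ?thesis
    using potential_bound[of s U "\<lambda>j. ([], I0 j, {})"] assms by (simp add: k_aw_scheme_eq_run)
qed

end

section \<open>The lower tail bound\<close>

theorem theorem3:
  fixes U :: "'a::finite set"
    and k :: nat
    and Ind :: "nat \<Rightarrow> 'a set set"
    and x :: "real ^ 'a"
    and m :: "nat \<Rightarrow> nat"
    and \<beta> :: "nat \<Rightarrow> nat \<Rightarrow> real"
    and I :: "nat \<Rightarrow> nat \<Rightarrow> 'a set"
    and \<Phi> :: "nat \<Rightarrow> 'a exchange_rule"
    and a :: "'a \<Rightarrow> real"
    and \<delta> :: real
  assumes "1 \<le> k"
    and "\<And>j. j < k \<Longrightarrow> matroid U (Ind j)"
    and "x \<in> (\<Inter>j\<in>{..<k}. indep_polytope (Ind j))"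
    and "\<And>j. j < k \<Longrightarrow> convex_decomposition U (Ind j) x (m j) (\<beta> j) (I j)"
    and "\<And>j. j < k \<Longrightarrow> valid_exchange_rule (Ind j) (m j) (\<Phi> j)"
    and "\<And>e. e \<in> U \<Longrightarrow> a e \<in> {0..1}"
    and "\<delta> \<in> {0<..<1/5}"
  shows "let Q = (\<Sum>e\<in>U. a e * x $ e) in
    measure_pmf.prob (k_aw_scheme U x k m \<beta> I \<Phi>)
      {S. (\<Sum>e\<in>S. a e) \<le> (1/5 - \<delta>) * (Q / (real k + 1))}
    \<le> 4 * exp (- (\<delta>\<^sup>2 * Q / (3 * (real k + 1) ^ 3)))"
proof -
  interpret k_aw U k Ind x m \<beta> I \<Phi> a
    using assms by unfold_locales auto
  define Q where "Q = (\<Sum>e\<in>U. a e * x $ e)"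
  define q where "q = Q / (real k + 1)"
  define \<theta> where "\<theta> = (1/5 - \<delta>) * q"
  let ?M = "k_aw_scheme U x k m \<beta> I \<Phi>"
  have "0 \<le> Q"
    unfolding Q_def using assms(6) x_nonneg by (auto intro!: sum_nonneg mult_nonneg_nonneg)
  then have q: "0 \<le> q" by (simp add: q_def)
  have "measure_pmf.prob ?M {S. sum a S \<le> \<theta>} =
      measure_pmf.expectation ?M (indicator {S. sum a S \<le> \<theta>})"
    by simp
  \<comment> \<open>Markov's inequality with \<open>s = 1/2\<close>: on the event,
    \<open>2 powr (\<theta> - sum a S)\<close> is at least 1.\<close>
  also have "\<dots> \<le> measure_pmf.expectation ?M (\<lambda>S. 2 powr \<theta> * (1 - 1/2) powr sum a S)"
  proof (rule integral_mono)
    fix S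
    have "1 \<le> 2 powr (\<theta> - sum a S)" if "sum a S \<le> \<theta>"
      using that by (simp add: ge_one_powr_ge_zero)
    then show "indicator {S. sum a S \<le> \<theta>} S \<le> 2 powr \<theta> * (1 - 1/2) powr sum a S"
      by (auto simp: indicator_def powr_diff powr_divide)
  qed (auto intro!: integrable_measure_pmf_finite)
  also have "\<dots> \<le> 2 powr \<theta> * (1 + 1/2) powr (- Q / (real k + 1))"
    using exponential_moment[of "1/2"] by (simp add: Q_def)
  also have "\<dots> = exp (\<theta> * ln 2 - q * ln (3/2))"
    by (simp add: powr_def q_def flip: exp_add)
  \<comment> \<open>From \<open>\<theta> * ln 2 \<le> q / 5\<close> and
    \<open>q * ln (3/2) \<ge> q / 3\<close> the exponent is at most \<open>- (2/15) * q\<close>. The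
    claimed exponent is milder, as its coefficient of \<open>q\<close> has absolute value at most
    \<open>1/75\<close>.\<close>
  also have "\<dots> \<le> exp (- (\<delta>\<^sup>2 * Q / (3 * (real k + 1) ^ 3)))"
  proof -
    have "\<theta> \<le> 1/5 * q"
      using q assms(7) unfolding \<theta>_def by (intro mult_right_mono) auto
    then have "\<theta> * ln 2 \<le> (1/5 * q) * 1"
      using q ln_2_less_1 by (intro mult_mono) auto
    moreover have "ln (3/2 :: real) \<ge> 1/3"
      using ln_le_minus_one[of "2/3 :: real"] by (simp add: ln_div)
    then have "q * (1/3) \<le> q * ln (3/2)"
      using q by (rule mult_left_mono)
    moreover have "\<delta>\<^sup>2 * Q / (3 * (real k + 1) ^ 3) \<le> q * (2/15)"
    proof -
      have "\<delta>\<^sup>2 \<le> (1/5)\<^sup>2" using assms(7) by (intro power_mono) auto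
      moreover have "1 \<le> (real k + 1)\<^sup>2" by (rule one_le_power) simp
      ultimately have "\<delta>\<^sup>2 / (3 * (real k + 1)\<^sup>2) \<le> (1/5)\<^sup>2 / (3 * 1)"
        by (intro frac_le) auto
      also have "\<dots> \<le> 2/15" by (simp add: power2_eq_square)
      finally have "q * (\<delta>\<^sup>2 / (3 * (real k + 1)\<^sup>2)) \<le> q * (2/15)"
        using q by (rule mult_left_mono)
      then show ?thesis
        by (simp add: q_def power3_eq_cube power2_eq_square mult_ac)
    qed
    ultimately show ?thesis unfolding exp_le_cancel_iff by linarith
  qed
  \<comment> \<open>The factor 4 is pure slack.\<close>
  also have "\<dots> \<le> 4 * exp (- (\<delta>\<^sup>2 * Q / (3 * (real k + 1) ^ 3)))"
    by simp
  finally show ?thesis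
    unfolding Let_def Q_def \<theta>_def q_def .
qed

end
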